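(* Let $f\in\mathbb{R}[x_1,\dots,x_n]$ be a polynomial and let $\mathbf{K}\subseteq\mathbb{R}^n$ be a convex body. Then there is a constant $c>0$ depending on $f$ and $\mathbf{K}$ only, such that for every integer $r\ge 1$, $$\underline{f}^{(2r)}_{\mathbf{K}} - \min_{x\in\mathbf{K}}f(x)\;\le\;\frac{c}{r}.$$ A suitable value for $c$ is $$c=(ne+1)\left(f_{\min,\mathbf{K}}+C^1_f\cdot\mathrm{diam}(\mathbf{K})+C^2_f\cdot\mathrm{diam}(\mathbf{K})^2\right),$$ where $f_{\min,\mathbf{K}}=\min_{x\in\mathbf{K}}f(x)$, $C^1_f=\max_{x\in\mathbf{K}}\|\nabla f(x)\|_2$, $C^2_f=\max_{x\in\mathbf{K}}\|\nabla^2 f(x)\|_2$, and $e$ is the base of the natural logarithm.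
   Context: A convex body is a compact convex subset of $\mathbb{R}^n$ with nonempty interior. For an integer $s\ge 0$, $\Sigma[x]_s$ denotes the set of polynomials in $\mathbb{R}[x_1,\dots,x_n]$ of degree at most $2s$ that are sums of squares of polynomials. The Lasserre measure-based upper bound of order $s$ on the minimum of $f$ over $\mathbf{K}$ is $$\underline{f}^{(s)}_{\mathbf{K}}:=\inf\Big\{\int_{\mathbf{K}}h(x)f(x)\,dx \;:\; h\in\Sigma[x]_s,\ \int_{\mathbf{K}}h(x)\,dx=1\Big\},$$ with integration with respect to Lebesgue measure. $\|\nabla f(x)\|_2$ is the Euclidean norm of the gradient, $\|\nabla^2 f(x)\|_2$ is the spectral norm of the Hessian, and $\mathrm{diam}(\mathbf{K})$ is the Euclidean diameter of $\mathbf{K}$.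
   Formalization: The explicit value of c fails as written when the minimum of f on K is negative (e.g. f = -1 gives c < 0), so it is proved as written only when the minimum is nonnegative, and for all f with the absolute value of the minimum in its place. *)

theory Defs
  imports "HOL-Analysis.Analysis" "HOL-Library.Poly_Mapping"
begin

text \<open>
  Polynomials in the real variables indexed by \<open>'n\<close> are finitely supported maps from
  exponent vectors to coefficients; ring operations are those of \<^theory>\<open>HOL-Library.Poly_Mapping\<close>
  (multiplication is convolution).
\<close>

type_synonym 'n rpoly = "('n \<Rightarrow>\<^sub>0 nat) \<Rightarrow>\<^sub>0 real"

definition peval :: "'n::finite rpoly \<Rightarrow> real ^ 'n \<Rightarrow> real" where
  "peval p x = (\<Sum>m\<in>Poly_Mapping.keys p.
     Poly_Mapping.lookup p m * (\<Prod>i\<in>UNIV. (x $ i) ^ Poly_Mapping.lookup m i))"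

text \<open>The zero polynomial gets degree \<open>0\<close>; only upper bounds on degrees are used.\<close>

definition total_degree :: "'n::finite rpoly \<Rightarrow> nat" where
  "total_degree p =
     Max (insert 0 ((\<lambda>m. \<Sum>i\<in>UNIV. Poly_Mapping.lookup m i) ` Poly_Mapping.keys p))"

definition sos_polys :: "nat \<Rightarrow> 'n::finite rpoly set" where
  "sos_polys s = {p. total_degree p \<le> 2 * s \<and> (\<exists>qs. p = (\<Sum>q\<leftarrow>qs. q ^ 2))}"

definition convex_body :: "(real ^ 'n::finite) set \<Rightarrow> bool" where
  "convex_body K \<longleftrightarrow> compact K \<and> convex K \<and> interior K \<noteq> {}"

text \<open>
  On a convex body the set below is nonempty (take a constant \<open>h\<close>) and bounded below
  (sums of squares are nonnegative), so the infimum in the reals is the true infimum.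
\<close>

definition lasserre_bound :: "(real ^ 'n::finite) set \<Rightarrow> 'n rpoly \<Rightarrow> nat \<Rightarrow> real" where
  "lasserre_bound K f s =
     Inf {(LINT x:K|lborel. peval h x * peval f x) | h.
            h \<in> sos_polys s \<and> (LINT x:K|lborel. peval h x) = 1}"

definition grad :: "(real ^ 'n::finite \<Rightarrow> real) \<Rightarrow> real ^ 'n \<Rightarrow> real ^ 'n" where
  "grad g x = (\<chi> i. frechet_derivative g (at x) (axis i 1))"

definition hessian :: "(real ^ 'n::finite \<Rightarrow> real) \<Rightarrow> real ^ 'n \<Rightarrow> real ^ 'n ^ 'n" where
  "hessian g x = jacobian (grad g) (at x)"

definition spectral_norm :: "real ^ 'n::finite ^ 'n \<Rightarrow> real" where
  "spectral_norm A = onorm ((*v) A)"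

text \<open>
  The functions below are continuous in \<open>x\<close>, so over a nonempty compact set the infimum
  is the minimum and the suprema are maxima. Note that \<open>f_min K f\<close> may be negative: for \<open>f = -1\<close>
  the constant \<open>(n e + 1) (f_min + C1 diam + C2 diam^2)\<close> is negative while the error of the
  bound is zero, so for negative \<open>f_min\<close> it must enter this constant by its absolute value.
\<close>

definition f_min :: "(real ^ 'n::finite) set \<Rightarrow> 'n rpoly \<Rightarrow> real" where
  "f_min K f = (INF x\<in>K. peval f x)"

definition C1 :: "(real ^ 'n::finite) set \<Rightarrow> 'n rpoly \<Rightarrow> real" where
  "C1 K f = (SUP x\<in>K. norm (grad (peval f) x))"

definition C2 :: "(real ^ 'n::finite) set \<Rightarrow> 'n rpoly \<Rightarrow> real" where
  "C2 K f = (SUP x\<in>K. spectral_norm (hessian (peval f) x))"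

end

theory Submission
  imports Defs
begin

text \<open>
  Let \<open>a\<close> minimise \<open>f\<close> on \<open>K\<close>. By Taylor's formula, \<open>f - f a\<close> is bounded above on \<open>K\<close> by the convex
  quadratic \<open>G x = grad f a \<bullet> (x - a) + C2 / 2 * \<bar>x - a\<bar>\<^sup>2\<close>, which is nonnegative on \<open>K\<close> since \<open>a\<close> is a
  minimiser. Put \<open>y = G / M\<close> for some \<open>M > C1 diam K + C2 (diam K)\<^sup>2\<close>, so that \<open>0 \<le> y < 1\<close> on \<open>K\<close>, and use
  as density the normalised square \<open>(1 - y)^(2 r)\<close> of degree at most \<open>4 r\<close>. Comparing the integral of
  \<open>(1 - y)^(N + 1)\<close> over \<open>K\<close> with that over \<open>a + t (K - a)\<close>, where \<open>y (a + t (x - a)) \<le> t y x\<close>, and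
  letting \<open>t\<close> tend to \<open>1\<close> shows that \<open>y\<close> has mean at most \<open>n / (n + N + 1)\<close> for the density
  proportional to \<open>(1 - y)^N\<close>. With \<open>N = 2 r\<close> the error is at most \<open>n M / (2 r)\<close>, which is
  below the claimed bound.
\<close>

subsection \<open>Evaluation and degree of polynomials\<close>

abbreviation pconst :: "real \<Rightarrow> 'n::finite rpoly"
  where "pconst c \<equiv> Poly_Mapping.single 0 c"

definition pvar :: "'n::finite \<Rightarrow> 'n rpoly"
  where "pvar i = Poly_Mapping.single (Poly_Mapping.single i 1) 1"

text \<open>Updating at a fresh exponent amounts to adding a monomial. In this form the induction
  step matches facts that are additive in the polynomial.\<close>

lemma rpoly_induct [case_names zero add]:
  fixes p :: "'n::finite rpoly"
  assumes "P 0" "\<And>p m c. P p \<Longrightarrow> P (p + Poly_Mapping.single m c)"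
  shows "P p"
proof (induction p rule: update_induct)
  case const
  then show ?case using assms(1) unfolding zero_poly_mapping_def .
next
  case (update p m c)
  have "Poly_Mapping.update m c p = p + Poly_Mapping.single m c"
    using update.hyps
    by (intro poly_mapping_eqI)
       (auto simp: lookup_update lookup_add lookup_single when_def in_keys_iff)
  then show ?case using assms(2)[OF update.IH] by simp
qed

section \<open>Evaluation as a ring homomorphism\<close>

lemma peval_zero [simp]: "peval 0 x = 0"
  by (simp add: peval_def)

lemma peval_add [simp]: "peval (p + q) x = peval p x + peval q x"
  unfolding peval_def by (rule setsum_keys_plus_distrib) (simp_all add: algebra_simps)

lemma peval_single:
  "peval (Poly_Mapping.single m c) x = c * (\<Prod>i\<in>UNIV. (x $ i) ^ Poly_Mapping.lookup m i)"
  by (simp add: peval_def)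

lemma peval_const [simp]: "peval (pconst c) x = c"
  by (simp add: peval_single)

lemma peval_one [simp]: "peval 1 x = 1"
  using peval_const[of 1 x] by simp

lemma peval_var [simp]: "peval (pvar i) x = x $ i"
proof -
  have "(\<Prod>j\<in>UNIV. (x $ j) ^ Poly_Mapping.lookup (Poly_Mapping.single i (1::nat)) j)
        = (\<Prod>j\<in>UNIV. if j = i then x $ i else 1)"
    by (rule prod.cong) (auto simp: lookup_single when_def)
  then show ?thesis by (simp add: pvar_def peval_single)
qed

text \<open>Monomials multiply by adding exponents. This is the monomial case of multiplicativity;
  additivity in the other factor then gives \<open>peval_mult\<close>.\<close>

lemma peval_single_mult:
  "peval (Poly_Mapping.single m c * q) x = peval (Poly_Mapping.single m c) x * peval q x"
  by (induction q rule: rpoly_induct)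
     (simp_all add: distrib_left mult_single peval_single lookup_add power_add prod.distrib)

lemma peval_mult [simp]: "peval (p * q) x = peval p x * peval q x"
  by (induction p rule: rpoly_induct) (simp_all add: distrib_right peval_single_mult)

lemma peval_uminus [simp]: "peval (- p) x = - peval p x"
  using peval_add[of p "- p" x] by simp

lemma peval_diff [simp]: "peval (p - q) x = peval p x - peval q x"
  using peval_add[of p "- q" x] by simp

lemma peval_power [simp]: "peval (p ^ k) x = peval p x ^ k"
  by (induction k) simp_all

lemma peval_sum [simp]: "peval (\<Sum>i\<in>A. p i) x = (\<Sum>i\<in>A. peval (p i) x)"
  by (induction A rule: infinite_finite_induct) simp_all

lemma peval_sum_list [simp]: "peval (sum_list ps) x = (\<Sum>p\<leftarrow>ps. peval p x)"
  by (induction ps) simp_all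

lemma peval_sos_nonneg: "h \<in> sos_polys s \<Longrightarrow> 0 \<le> peval h x"
  by (auto simp: sos_polys_def intro!: sum_list_nonneg)

section \<open>Upper bounds on the total degree\<close>

lemma total_degree_le_iff:
  "total_degree p \<le> d \<longleftrightarrow> (\<forall>m\<in>Poly_Mapping.keys p. (\<Sum>i\<in>UNIV. Poly_Mapping.lookup m i) \<le> d)"
  by (simp add: total_degree_def)

text \<open>Measuring both summands against a common free bound \<open>d\<close> lets degree
  estimates chain as introduction rules.\<close>

lemma total_degree_add_le:
  assumes "total_degree p \<le> d" "total_degree q \<le> d"
  shows "total_degree (p + q) \<le> d"
  using assms keys_add[of p q] by (auto simp: total_degree_le_iff)

lemma total_degree_uminus [simp]: "total_degree (- p) = total_degree p"
  by (simp add: total_degree_def)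

lemma total_degree_diff_le:
  assumes "total_degree p \<le> d" "total_degree q \<le> d"
  shows "total_degree (p - q) \<le> d"
  using total_degree_add_le[of p d "- q"] assms by simp

lemma total_degree_sum_le:
  assumes "\<And>i. i \<in> A \<Longrightarrow> total_degree (p i) \<le> d"
  shows "total_degree (\<Sum>i\<in>A. p i) \<le> d"
  using assms
proof (induction A rule: infinite_finite_induct)
  case (insert i A)
  then show ?case by (simp add: total_degree_add_le)
qed (simp_all add: total_degree_def)

lemma total_degree_mult_le:
  assumes "total_degree p \<le> d" "total_degree q \<le> e"
  shows "total_degree (p * q) \<le> d + e"
  unfolding total_degree_le_iff
proof
  fix m assume "m \<in> Poly_Mapping.keys (p * q)"
  then obtain k l where "m = k + l" "k \<in> Poly_Mapping.keys p" "l \<in> Poly_Mapping.keys q"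
    using keys_mult[of p q] by blast
  then show "(\<Sum>i\<in>UNIV. Poly_Mapping.lookup m i) \<le> d + e"
    using assms by (simp add: total_degree_le_iff lookup_add sum.distrib add_mono)
qed

lemma total_degree_const [simp]: "total_degree (pconst c) = 0"
  by (simp add: total_degree_def)

lemma total_degree_one [simp]: "total_degree 1 = 0"
  by (simp add: total_degree_def)

lemma total_degree_power_le:
  assumes "total_degree p \<le> d"
  shows "total_degree (p ^ k) \<le> d * k"
proof (induction k)
  case 0
  show ?case by simp
next
  case (Suc k)
  then show ?case using total_degree_mult_le[OF assms Suc] by simp
qed

lemma total_degree_var: "total_degree (pvar i) \<le> 1"
proof -
  have "(\<Sum>j\<in>UNIV. Poly_Mapping.lookup (Poly_Mapping.single i (1::nat)) j)
        = (\<Sum>j\<in>UNIV. if j = i then 1 else 0)"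
    by (rule sum.cong) (auto simp: lookup_single when_def)
  then show ?thesis by (simp add: pvar_def total_degree_le_iff)
qed

text \<open>Constants and variables generate the polynomial ring. Differentiation can then rest on
  the sum and product rules alone.\<close>

lemma rpoly_ring_induct [case_names const var add mult]:
  fixes p :: "'n::finite rpoly"
  assumes const: "\<And>c. P (pconst c)" and var: "\<And>i. P (pvar i)"
    and add: "\<And>p q. P p \<Longrightarrow> P q \<Longrightarrow> P (p + q)"
    and mult: "\<And>p q. P p \<Longrightarrow> P q \<Longrightarrow> P (p * q)"
  shows "P p"
proof -
  have monom: "P (Poly_Mapping.single m c)" for m c
  proof (induction m arbitrary: c rule: update_induct)
    case const
    then show ?case using assms(1)[of c] unfolding zero_poly_mapping_def .
  next
    case (update m i k)
    have pow: "P (pvar i ^ j)" for j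
      by (induction j) (use const[of 1] in \<open>simp_all add: var mult\<close>)
    have "pvar i * Poly_Mapping.single (Poly_Mapping.single i j) 1
        = Poly_Mapping.single (Poly_Mapping.single i (Suc j)) (1::real)" for j
      by (simp add: pvar_def mult_single single_add[symmetric])
    then have "pvar i ^ j = Poly_Mapping.single (Poly_Mapping.single i j) 1" for j
      by (induction j) simp_all
    \<comment> \<open>The index \<open>i\<close> is fresh for \<open>m\<close>, so setting its
      exponent to \<open>k\<close> multiplies the monomial by the \<open>k\<close>-th power of the
      variable.\<close>
    moreover have "Poly_Mapping.update i k m = Poly_Mapping.single i k + m"
      using update.hyps
      by (intro poly_mapping_eqI)
         (auto simp: lookup_update lookup_add lookup_single when_def in_keys_iff)
    ultimately have "Poly_Mapping.single (Poly_Mapping.update i k m) c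
        = pvar i ^ k * Poly_Mapping.single m c"
      by (simp add: mult_single)
    then show ?case using mult[OF pow update.IH] by simp
  qed
  show ?thesis
    by (induction p rule: rpoly_induct) (use const[of 0] in \<open>simp_all add: add monom\<close>)
qed

subsection \<open>Derivatives of polynomial functions\<close>

text \<open>The partial derivatives \<open>q i\<close> are again polynomials, so the lemma can be
  applied once more to them. This yields the Hessian and all continuity facts.\<close>

lemma peval_has_derivative:
  fixes p :: "'n::finite rpoly"
  shows "\<exists>q. \<forall>x. (peval p has_derivative (\<lambda>h. \<Sum>i\<in>UNIV. h $ i * peval (q i) x)) (at x)"
proof (induction p rule: rpoly_ring_induct)
  case (const c)
  have "peval (pconst c :: 'n rpoly) = (\<lambda>x. c)" by auto
  then show ?case by (intro exI[of _ "\<lambda>i. 0"]) simp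
next
  case (var i)
  have "peval (pvar i) = (\<lambda>x. x $ i)" by auto
  moreover have "(\<Sum>j\<in>UNIV. h $ j * (if j = i then 1 else 0)) = h $ i" for h :: "real ^ 'n"
    by (simp add: if_distrib cong: if_cong)
  ultimately show ?case
    by (intro exI[of _ "\<lambda>j. pconst (if j = i then 1 else 0)"])
       (auto intro!: derivative_eq_intros bounded_linear_imp_has_derivative bounded_linear_vec_nth)
next
  case (add p p')
  then obtain q q' where
    "\<And>x. (peval p has_derivative (\<lambda>h. \<Sum>i\<in>UNIV. h $ i * peval (q i) x)) (at x)"
    "\<And>x. (peval p' has_derivative (\<lambda>h. \<Sum>i\<in>UNIV. h $ i * peval (q' i) x)) (at x)" by blast
  note d = has_derivative_add[OF this]
  have "peval (p + p') = (\<lambda>x. peval p x + peval p' x)" by auto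
  with d show ?case
    by (intro exI[of _ "\<lambda>i. q i + q' i"]) (simp add: distrib_left sum.distrib)
next
  case (mult p p')
  then obtain q q' where
    "\<And>x. (peval p has_derivative (\<lambda>h. \<Sum>i\<in>UNIV. h $ i * peval (q i) x)) (at x)"
    "\<And>x. (peval p' has_derivative (\<lambda>h. \<Sum>i\<in>UNIV. h $ i * peval (q' i) x)) (at x)" by blast
  note d = has_derivative_mult[OF this]
  have "peval (p * p') = (\<lambda>x. peval p x * peval p' x)" by auto
  with d show ?case
    by (intro exI[of _ "\<lambda>i. p * q' i + q i * p'"])
       (simp add: distrib_left sum.distrib sum_distrib_left sum_distrib_right mult_ac)
qed

lemma continuous_on_peval [continuous_intros]: "continuous_on S (peval p)"
  by (meson peval_has_derivative has_derivative_continuous continuous_at_imp_continuous_on)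

section \<open>Gradient and Hessian, and boundedness of their norms\<close>

lemma grad_peval_nth:
  assumes "(peval p has_derivative (\<lambda>h. \<Sum>i\<in>UNIV. h $ i * peval (q i) x)) (at x)"
  shows "grad (peval p) x $ i = peval (q i) x"
  unfolding grad_def frechet_derivative_at[OF assms, symmetric]
  by (simp add: axis_def if_distrib if_distribR cong: if_cong)

lemma peval_has_derivative_grad:
  "(peval p has_derivative (\<lambda>h. grad (peval p) x \<bullet> h)) (at x)"
proof -
  obtain q where q: "(peval p has_derivative (\<lambda>h. \<Sum>i\<in>UNIV. h $ i * peval (q i) x)) (at x)"
    using peval_has_derivative by blast
  then show ?thesis by (simp add: inner_vec_def mult.commute grad_peval_nth[OF q])
qed

lemma grad_peval_poly:
  obtains q where "grad (peval p) = (\<lambda>x. \<chi> i. peval (q i) x)"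
proof -
  obtain q where "\<And>x. (peval p has_derivative (\<lambda>h. \<Sum>i\<in>UNIV. h $ i * peval (q i) x)) (at x)"
    using peval_has_derivative by blast
  then show ?thesis by (intro that[of q]) (auto simp: vec_eq_iff grad_peval_nth)
qed

lemma continuous_on_grad_peval: "continuous_on S (grad (peval p))"
  by (rule grad_peval_poly[of p]) (auto intro!: continuous_intros)

lemma grad_peval_has_derivative:
  "(grad (peval p) has_derivative (\<lambda>h. hessian (peval p) x *v h)) (at x)"
proof -
  obtain q where q: "grad (peval p) = (\<lambda>x. \<chi> i. peval (q i) x)" by (rule grad_peval_poly)
  have "((\<lambda>x. \<chi> i. peval (q i) x) has_derivative (\<lambda>h. \<chi> i. grad (peval (q i)) x \<bullet> h)) (at x)"
    by (subst has_derivative_componentwise_within)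
       (auto simp: Basis_vec_def inner_axis intro: peval_has_derivative_grad)
  \<comment> \<open>The Jacobian represents the derivative wherever the map is differentiable; the
    componentwise derivative above supplies differentiability.\<close>
  then show ?thesis
    unfolding hessian_def q[symmetric] using differentiableI jacobian_works by blast
qed

text \<open>By uniqueness of derivatives, row \<open>i\<close> of the Hessian is the gradient of the
  polynomial that gives component \<open>i\<close> of the gradient.\<close>

lemma continuous_on_hessian_entry: "continuous_on S (\<lambda>x. hessian (peval p) x $ i $ j)"
proof -
  obtain q where q: "grad (peval p) = (\<lambda>x. \<chi> i. peval (q i) x)" by (rule grad_peval_poly)
  have "hessian (peval p) x $ i $ j = grad (peval (q i)) x $ j" for x
  proof -
    have "((\<lambda>x. grad (peval p) x $ i) has_derivative (\<lambda>h. (hessian (peval p) x *v h) $ i)) (at x)"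
      by (rule bounded_linear.has_derivative[OF bounded_linear_vec_nth grad_peval_has_derivative])
    moreover have "(\<lambda>x. grad (peval p) x $ i) = peval (q i)" by (simp add: q)
    ultimately have "(\<lambda>h. (hessian (peval p) x *v h) $ i) = (\<lambda>h. grad (peval (q i)) x \<bullet> h)"
      using has_derivative_unique peval_has_derivative_grad by metis
    from fun_cong[OF this, of "axis j 1"] show ?thesis
      by (simp add: inner_axis matrix_vector_mult_basis column_def)
  qed
  then show ?thesis by (simp add: continuous_on_grad_peval continuous_on_component)
qed

lemma bdd_above_norm_grad: "compact K \<Longrightarrow> bdd_above ((\<lambda>x. norm (grad (peval p) x)) ` K)"
  by (intro bounded_imp_bdd_above compact_imp_bounded compact_continuous_image
      continuous_on_norm continuous_on_grad_peval)

text \<open>The operator norm is at most the sum of the absolute values of the entries, which is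
  continuous. Boundedness makes the supremum in \<open>C2\<close> an actual upper bound.\<close>

lemma bdd_above_spectral_norm_hessian:
  assumes "compact K"
  shows "bdd_above ((\<lambda>x. spectral_norm (hessian (peval p) x)) ` K)"
proof -
  let ?g = "\<lambda>x. \<Sum>i\<in>UNIV. \<Sum>j\<in>UNIV. \<bar>hessian (peval p) x $ i $ j\<bar>"
  have "bdd_above (?g ` K)"
    using assms by (intro bounded_imp_bdd_above compact_imp_bounded compact_continuous_image
      continuous_on_sum continuous_on_rabs continuous_on_hessian_entry)
  then obtain B where B: "\<And>x. x \<in> K \<Longrightarrow> ?g x \<le> B"
    unfolding bdd_above_def by blast
  show ?thesis
    unfolding spectral_norm_def
    by (rule bdd_aboveI2) (rule order_trans[OF onorm_le_matrix_component_sum B])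
qed

subsection \<open>Integrals over star-shaped dilations\<close>

lemma set_integrable_compact:
  fixes g :: "'a::euclidean_space \<Rightarrow> real"
  assumes "compact K" "continuous_on K g"
  shows "set_integrable lborel K g"
  unfolding set_integrable_def using assms by (rule borel_integrable_compact)

text \<open>The left side is the integral of \<open>g\<close> over the copy of \<open>K\<close>
  shrunk towards \<open>a\<close> by the factor \<open>t\<close>. By convexity this copy lies in
  \<open>K\<close>, and \<open>g\<close> is nonnegative there.\<close>

lemma set_integral_homothety_le:
  fixes g :: "'a::euclidean_space \<Rightarrow> real"
  assumes K: "compact K" "convex K" "a \<in> K" and g: "continuous_on K g"
    and nonneg: "\<And>x. x \<in> K \<Longrightarrow> 0 \<le> g x" and t: "0 < t" "t \<le> 1"
  shows "t ^ DIM('a) * (LINT x:K|lborel. g ((1 - t) *\<^sub>R a + t *\<^sub>R x)) \<le> (LINT x:K|lborel. g x)"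
proof -
  let ?T = "\<lambda>x. (1 - t) *\<^sub>R a + t *\<^sub>R x"
  let ?F = "\<lambda>x. indicator K x *\<^sub>R g x"
  have TK: "?T x \<in> K" if "x \<in> K" for x
    using convexD_alt[OF K(2) K(3) that, of t] t by simp
  have intF: "integrable lborel ?F"
    using K(1) g by (rule borel_integrable_compact)
  then have mF: "?F \<in> borel_measurable borel" by auto
  have gT: "continuous_on K (\<lambda>x. g (?T x))"
    by (rule continuous_on_compose2[OF g]) (auto intro!: continuous_intros TK)
  \<comment> \<open>The change of variables: Lebesgue measure is its own image under
    \<open>?T\<close>, weighted by the Jacobian factor.\<close>
  have l: "lborel = density (distr lborel borel ?T) (\<lambda>_. ennreal (t ^ DIM('a)))"
    using lborel_affine[of t "(1 - t) *\<^sub>R a"] t by (simp add: ennreal_power)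
  have "integrable (density (distr lborel borel ?T) (\<lambda>_. ennreal (t ^ DIM('a)))) ?F"
    using intF l by simp
  then have iT: "integrable lborel (\<lambda>x. t ^ DIM('a) * ?F (?T x))"
    using mF t
    by (subst (asm) integrable_density) (auto dest!: integrable_distr[rotated])
  have "(LINT x:K|lborel. g x) = integral\<^sup>L (density (distr lborel borel ?T) (\<lambda>_. ennreal (t ^ DIM('a)))) ?F"
    unfolding set_lebesgue_integral_def using l by simp
  also have "\<dots> = integral\<^sup>L (distr lborel borel ?T) (\<lambda>x. t ^ DIM('a) * ?F x)"
    using mF t by (subst integral_density) auto
  also have "\<dots> = (LINT x|lborel. t ^ DIM('a) * ?F (?T x))"
    using mF by (subst integral_distr) auto
  finally have eq: "(LINT x:K|lborel. g x) = (LINT x|lborel. t ^ DIM('a) * ?F (?T x))" .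
  have "t ^ DIM('a) * (LINT x:K|lborel. g (?T x)) = (LINT x|lborel. t ^ DIM('a) * (indicator K x *\<^sub>R g (?T x)))"
    unfolding set_lebesgue_integral_def by simp
  \<comment> \<open>The cutoff changes from \<open>x\<close> in \<open>K\<close> to
    \<open>?T x\<close> in \<open>K\<close>, a weaker condition; what is added is
    nonnegative.\<close>
  also have "\<dots> \<le> (LINT x|lborel. t ^ DIM('a) * ?F (?T x))"
  proof (rule integral_mono)
    show "integrable lborel (\<lambda>x. t ^ DIM('a) * (indicator K x *\<^sub>R g (?T x)))"
      using borel_integrable_compact[OF K(1) gT] by (rule integrable_mult_right)
    show "integrable lborel (\<lambda>x. t ^ DIM('a) * ?F (?T x))" by (rule iT)
    show "t ^ DIM('a) * (indicator K x *\<^sub>R g (?T x)) \<le> t ^ DIM('a) * ?F (?T x)" for x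
      using TK[of x] nonneg[of "?T x"] t
      by (intro mult_left_mono) (auto simp: indicator_def)
  qed
  finally show ?thesis using eq by simp
qed

text \<open>The tangent of a convex power at \<open>x\<close> lies below its graph.\<close>

lemma power_tangent_le:
  fixes x y :: real
  assumes "0 \<le> x" "x \<le> y"
  shows "x ^ Suc N + real (Suc N) * (y - x) * x ^ N \<le> y ^ Suc N"
proof (induction N)
  case (Suc N)
  have "x ^ Suc (Suc N) + real (Suc (Suc N)) * (y - x) * x ^ Suc N
      = x * (x ^ Suc N + real (Suc N) * (y - x) * x ^ N) + (y - x) * x ^ Suc N"
    by (simp add: algebra_simps)
  also have "\<dots> \<le> x * y ^ Suc N + (y - x) * y ^ Suc N"
    using assms Suc by (intro add_mono mult_left_mono power_mono) auto
  also have "\<dots> = y ^ Suc (Suc N)" by (simp add: algebra_simps)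
  finally show ?case .
qed simp

text \<open>Comparing with the dilated copy gives
  \<open>t ^ n * (I + (1 - t) * (N + 1) * J) \<le> I\<close>. Dividing by \<open>1 - t\<close> and
  letting \<open>t\<close> tend to \<open>1\<close> gives \<open>(N + 1) * J \<le> n * I\<close>,
  where \<open>I\<close> is the integral of \<open>(1 - y) ^ N\<close> minus
  \<open>J\<close>.\<close>

lemma set_integral_power_le:
  fixes y :: "'a::euclidean_space \<Rightarrow> real"
  assumes K: "compact K" "convex K" "a \<in> K" and cont: "continuous_on K y"
    and range: "\<And>x. x \<in> K \<Longrightarrow> 0 \<le> y x \<and> y x \<le> 1"
    and star: "\<And>x t. x \<in> K \<Longrightarrow> 0 < t \<Longrightarrow> t < 1 \<Longrightarrow> y ((1 - t) *\<^sub>R a + t *\<^sub>R x) \<le> t * y x"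
  shows "real (DIM('a) + N + 1) * (LINT x:K|lborel. y x * (1 - y x) ^ N)
      \<le> real DIM('a) * (LINT x:K|lborel. (1 - y x) ^ N)"
proof -
  let ?I = "LINT x:K|lborel. (1 - y x) ^ Suc N"
  let ?J = "LINT x:K|lborel. y x * (1 - y x) ^ N"
  let ?n = "DIM('a)"
  note si = set_integrable_compact[OF K(1)]
  have I0: "0 \<le> ?I"
    unfolding set_lebesgue_integral_def
    by (rule Bochner_Integration.integral_nonneg) (auto simp: indicator_def range)
  have key: "t ^ ?n * (real (Suc N) * ?J) \<le> real ?n * ?I" if t: "0 < t" "t < 1" for t
  proof -
    have TK: "(1 - t) *\<^sub>R a + t *\<^sub>R x \<in> K" if "x \<in> K" for x
      using convexD_alt[OF K(2) K(3) that, of t] t by simp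
    have "?I + (1 - t) * (real (Suc N) * ?J)
        = (LINT x:K|lborel. (1 - y x) ^ Suc N + (1 - t) * (real (Suc N) * (y x * (1 - y x) ^ N)))"
      by (subst set_integral_add)
         (auto intro!: si continuous_intros cont simp del: power_Suc of_nat_Suc)
    also have "\<dots> \<le> (LINT x:K|lborel. (1 - y ((1 - t) *\<^sub>R a + t *\<^sub>R x)) ^ Suc N)"
    proof (rule set_integral_mono)
      fix x assume x: "x \<in> K"
      \<comment> \<open>The tangent is taken at \<open>1 - y x\<close> and evaluated at
        \<open>1 - t * y x\<close>, an increment of \<open>(1 - t) * y x\<close>.\<close>
      have "(1 - y x) ^ Suc N + real (Suc N) * ((1 - t * y x) - (1 - y x)) * (1 - y x) ^ N
          \<le> (1 - t * y x) ^ Suc N"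
        using range[OF x] t by (intro power_tangent_le) (auto intro: mult_left_le_one_le)
      also have "\<dots> \<le> (1 - y ((1 - t) *\<^sub>R a + t *\<^sub>R x)) ^ Suc N"
        using star[OF x t] range[OF x] t by (intro power_mono) (auto intro: mult_le_one)
      finally show "(1 - y x) ^ Suc N + (1 - t) * (real (Suc N) * (y x * (1 - y x) ^ N))
          \<le> (1 - y ((1 - t) *\<^sub>R a + t *\<^sub>R x)) ^ Suc N"
        by (simp add: algebra_simps)
    next
      show "set_integrable lborel K (\<lambda>x. (1 - y ((1 - t) *\<^sub>R a + t *\<^sub>R x)) ^ Suc N)"
        by (intro si continuous_intros continuous_on_compose2[OF cont]) (auto intro: TK)
    qed (intro si continuous_intros cont)
    finally have "t ^ ?n * (?I + (1 - t) * (real (Suc N) * ?J))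
        \<le> t ^ ?n * (LINT x:K|lborel. (1 - y ((1 - t) *\<^sub>R a + t *\<^sub>R x)) ^ Suc N)"
      using t by (intro mult_left_mono) auto
    also have "\<dots> \<le> ?I"
      using t range by (intro set_integral_homothety_le K continuous_intros cont) auto
    finally have "(1 - t) * (t ^ ?n * (real (Suc N) * ?J)) \<le> (1 - t ^ ?n) * ?I"
      by (simp add: algebra_simps)
    also have "\<dots> \<le> (1 - t) * real ?n * ?I"
    proof (rule mult_right_mono[OF _ I0])
      \<comment> \<open>Bernoulli's inequality extracts a factor \<open>1 - t\<close> from
        \<open>1 - t ^ n\<close>, which cancels the one on the left.\<close>
      have "1 + real ?n * (t - 1) \<le> t ^ ?n"
        using Bernoulli_inequality[of "t - 1" ?n] t by simp
      then show "1 - t ^ ?n \<le> (1 - t) * real ?n" by (simp add: algebra_simps)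
    qed
    finally show ?thesis using t by (simp add: mult.assoc)
  qed
  have "((\<lambda>t. t ^ ?n * (real (Suc N) * ?J)) \<longlongrightarrow> 1 ^ ?n * (real (Suc N) * ?J)) (at_left 1)"
    by (intro tendsto_intros)
  moreover have "\<forall>\<^sub>F t in at_left (1::real). t ^ ?n * (real (Suc N) * ?J) \<le> real ?n * ?I"
  proof (rule eventually_mono[OF eventually_at_left_real[of 0 1]])
    show "t ^ ?n * (real (Suc N) * ?J) \<le> real ?n * ?I" if "t \<in> {0<..<1}" for t
      using key[of t] that by (simp only: greaterThanLessThan_iff)
  qed simp
  ultimately have "real (Suc N) * ?J \<le> real ?n * ?I"
    using tendsto_upperbound by fastforce
  \<comment> \<open>One factor \<open>1 - y\<close> of the integrand is multiplied out.\<close>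
  moreover have "?I = (LINT x:K|lborel. (1 - y x) ^ N) - ?J"
    by (subst set_integral_diff(2)[symmetric])
       (auto intro!: si continuous_intros cont simp: algebra_simps)
  ultimately have "real (Suc N) * ?J \<le> real ?n * ((LINT x:K|lborel. (1 - y x) ^ N) - ?J)"
    by simp
  then show ?thesis by (simp add: algebra_simps)
qed

text \<open>The integral is at least the positive minimum of \<open>g\<close> times the volume of
  \<open>K\<close>, and \<open>K\<close> contains a ball. This permits normalising the
  density.\<close>

lemma set_integral_compact_pos:
  fixes g :: "'a::euclidean_space \<Rightarrow> real"
  assumes K: "compact K" "interior K \<noteq> {}" and g: "continuous_on K g"
    and pos: "\<And>x. x \<in> K \<Longrightarrow> 0 < g x"
  shows "0 < (LINT x:K|lborel. g x)"
proof -
  obtain b e where e: "0 < e" "ball b e \<subseteq> K"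
    using K(2) mem_interior by (metis equals0I)
  then have "K \<noteq> {}" by auto
  then obtain z where z: "z \<in> K" "\<And>x. x \<in> K \<Longrightarrow> g z \<le> g x"
    using continuous_attains_inf[OF K(1) _ g] by blast
  have K_fm: "K \<in> fmeasurable lborel"
    using K(1) by (rule fmeasurable_compact)
  have "0 < measure lborel (ball b e)"
    using e(1) by (rule content_ball_pos)
  also have "\<dots> \<le> measure lborel K"
    using e(2) K_fm by (intro measure_mono_fmeasurable) auto
  finally have "0 < measure lborel K * g z"
    using pos[OF z(1)] by simp
  also have "\<dots> = (LINT x:K|lborel. g z)"
    using K_fm by (subst set_integral_const) (auto simp: fmeasurable_def)
  also have "\<dots> \<le> (LINT x:K|lborel. g x)"
    by (intro set_integral_mono set_integrable_compact K g z continuous_intros) auto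
  finally show ?thesis .
qed

subsection \<open>The quadratic majorant and the error bound\<close>

lemma peval_segment_deriv:
  "((\<lambda>t. peval f (a + t *\<^sub>R d)) has_real_derivative grad (peval f) (a + t *\<^sub>R d) \<bullet> d) (at t)"
proof -
  have "((\<lambda>t. a + t *\<^sub>R d) has_derivative (\<lambda>s. s *\<^sub>R d)) (at t)"
    by (auto intro!: derivative_eq_intros)
  from has_derivative_compose[OF this peval_has_derivative_grad[of f]]
  show ?thesis by (rule has_derivative_imp_has_field_derivative) simp
qed

lemma grad_peval_segment_deriv:
  "((\<lambda>t. grad (peval f) (a + t *\<^sub>R d) \<bullet> d) has_real_derivative
     (hessian (peval f) (a + t *\<^sub>R d) *v d) \<bullet> d) (at t)"
proof -
  have "((\<lambda>t. a + t *\<^sub>R d) has_derivative (\<lambda>s. s *\<^sub>R d)) (at t)"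
    by (auto intro!: derivative_eq_intros)
  from has_derivative_inner_left[OF has_derivative_compose[OF this grad_peval_has_derivative[of f]], of d]
  show ?thesis
    by (rule has_derivative_imp_has_field_derivative) (simp add: matrix_vector_mult_scaleR)
qed

text \<open>First-order optimality on a convex set: \<open>a\<close> may lie on the boundary, so the
  gradient need not vanish. A negative slope would make \<open>f\<close> decrease along the segment
  towards \<open>x\<close>, which stays in \<open>K\<close>.\<close>

lemma peval_minimizer_grad_nonneg:
  assumes K: "convex K" "a \<in> K" "x \<in> K" and min: "\<And>y. y \<in> K \<Longrightarrow> peval f a \<le> peval f y"
  shows "0 \<le> grad (peval f) a \<bullet> (x - a)"
proof (rule ccontr)
  assume "\<not> ?thesis"
  then obtain e where e: "0 < e" "\<And>h. 0 < h \<Longrightarrow> h < e \<Longrightarrow> peval f (a + h *\<^sub>R (x - a)) < peval f a"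
    using DERIV_neg_dec_right[OF peval_segment_deriv[of f a "x - a" 0]] by auto
  \<comment> \<open>Strictly below \<open>e\<close> for the decrease, and at most \<open>1\<close>
    to stay on the segment.\<close>
  define h where "h = min (e / 2) 1"
  have h: "0 < h" "h < e" "h \<le> 1" using e(1) by (auto simp: h_def)
  have "a + h *\<^sub>R (x - a) = (1 - h) *\<^sub>R a + h *\<^sub>R x" by (simp add: algebra_simps)
  then have "a + h *\<^sub>R (x - a) \<in> K" using convexD_alt[OF K, of h] h by simp
  with min e(2)[OF h(1,2)] show False by fastforce
qed

section \<open>The constants \<open>C1\<close> and \<open>C2\<close>, and Taylor's formula\<close>

lemma C1_upper: "compact K \<Longrightarrow> x \<in> K \<Longrightarrow> norm (grad (peval f) x) \<le> C1 K f"
  unfolding C1_def by (rule cSUP_upper[OF _ bdd_above_norm_grad])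

lemma C2_upper: "compact K \<Longrightarrow> x \<in> K \<Longrightarrow> spectral_norm (hessian (peval f) x) \<le> C2 K f"
  unfolding C2_def by (rule cSUP_upper[OF _ bdd_above_spectral_norm_hessian])

lemma C1_nonneg: "compact K \<Longrightarrow> K \<noteq> {} \<Longrightarrow> 0 \<le> C1 K f"
  using C1_upper norm_ge_zero order_trans by (metis ex_in_conv)

lemma C2_nonneg:
  assumes "compact K" "K \<noteq> {}"
  shows "0 \<le> C2 K f"
proof -
  obtain x where "x \<in> K" using assms(2) by auto
  have "0 \<le> spectral_norm (hessian (peval f) x)"
    unfolding spectral_norm_def by (rule onorm_pos_le[OF matrix_vector_mul_bounded_linear])
  with C2_upper[OF assms(1) \<open>x \<in> K\<close>] show ?thesis by (rule order_trans[rotated])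
qed

text \<open>Taylor's formula with Lagrange remainder along the segment from \<open>a\<close> to
  \<open>x\<close>; the intermediate point lies in \<open>K\<close>, so \<open>C2\<close> bounds the
  second derivative there.\<close>

lemma peval_le_quadratic:
  assumes K: "compact K" "convex K" "a \<in> K" "x \<in> K"
  shows "peval f x \<le> peval f a + grad (peval f) a \<bullet> (x - a) + C2 K f / 2 * (norm (x - a))\<^sup>2"
proof -
  let ?d = "x - a"
  \<comment> \<open>The derivatives of orders 0, 1 and 2 along the segment, gathered in one family
    as \<open>Maclaurin\<close> requires.\<close>
  define D where "D m t = (if m = 0 then peval f (a + t *\<^sub>R ?d)
      else if m = 1 then grad (peval f) (a + t *\<^sub>R ?d) \<bullet> ?d
      else (hessian (peval f) (a + t *\<^sub>R ?d) *v ?d) \<bullet> ?d)" for m :: nat and t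
  have "\<forall>m t. m < 2 \<and> 0 \<le> t \<and> t \<le> 1 \<longrightarrow> DERIV (D m) t :> D (Suc m) t"
    by (auto simp: D_def[abs_def] less_2_cases_iff intro!: peval_segment_deriv grad_peval_segment_deriv)
  then obtain t where t: "0 < t" "t < 1"
    and eq: "D 0 1 = (\<Sum>m<2. D m 0 / fact m * 1 ^ m) + D 2 t / fact 2 * 1 ^ 2"
    using Maclaurin[of 1 2 D "D 0"] by auto
  let ?z = "a + t *\<^sub>R ?d"
  have "?z = (1 - t) *\<^sub>R a + t *\<^sub>R x" by (simp add: algebra_simps)
  then have z: "?z \<in> K" using convexD_alt[OF K(2-4), of t] t by simp
  have "(hessian (peval f) ?z *v ?d) \<bullet> ?d \<le> norm (hessian (peval f) ?z *v ?d) * norm ?d"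
    by (rule norm_cauchy_schwarz)
  also have "\<dots> \<le> (spectral_norm (hessian (peval f) ?z) * norm ?d) * norm ?d"
    unfolding spectral_norm_def
    by (intro mult_right_mono onorm[OF matrix_vector_mul_bounded_linear]) simp
  also have "\<dots> \<le> (C2 K f * norm ?d) * norm ?d"
    by (intro mult_right_mono C2_upper K z) simp_all
  finally have "D 2 t \<le> C2 K f * (norm ?d)\<^sup>2"
    by (simp add: D_def power2_eq_square mult.assoc)
  with eq show ?thesis by (simp add: D_def numeral_2_eq_2)
qed

section \<open>Upper bounds from explicit sum-of-squares densities\<close>

lemma f_min_le: "compact K \<Longrightarrow> x \<in> K \<Longrightarrow> f_min K f \<le> peval f x"
  unfolding f_min_def
  by (intro cINF_lower bounded_imp_bdd_below compact_imp_bounded compact_continuous_image continuous_on_peval)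

lemma lasserre_bound_le:
  assumes K: "compact K" and h: "h \<in> sos_polys s" "(LINT x:K|lborel. peval h x) = 1"
  shows "lasserre_bound K f s \<le> (LINT x:K|lborel. peval h x * peval f x)"
  unfolding lasserre_bound_def
proof (rule cInf_lower)
  show "bdd_below {(LINT x:K|lborel. peval h x * peval f x) |h.
      h \<in> sos_polys s \<and> (LINT x:K|lborel. peval h x) = 1}"
  \<comment> \<open>Averages of \<open>f\<close> against a probability density are at least its
    minimum; a real infimum is a lower bound only for sets bounded below.\<close>
  proof (rule bdd_belowI[of _ "f_min K f"], clarify)
    fix h :: "'a rpoly" assume h: "h \<in> sos_polys s" "(LINT x:K|lborel. peval h x) = 1"
    have "f_min K f = (LINT x:K|lborel. peval h x * f_min K f)" using h by simp
    also have "\<dots> \<le> (LINT x:K|lborel. peval h x * peval f x)"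
      by (intro set_integral_mono mult_left_mono f_min_le K peval_sos_nonneg[OF h(1)]
          set_integrable_compact continuous_intros)
    finally show "f_min K f \<le> (LINT x:K|lborel. peval h x * peval f x)" .
  qed
qed (use h in auto)

text \<open>Turns the Taylor majorant into a formal polynomial, so that powers of it have a degree
  that can be counted.\<close>

lemma quadratic_poly:
  fixes g a :: "real ^ 'n::finite" and c :: real
  obtains q :: "'n rpoly" where "total_degree q \<le> 2"
    "\<And>x. peval q x = g \<bullet> (x - a) + c * (norm (x - a))\<^sup>2"
proof
  let ?l = "\<lambda>i. pvar i - pconst (a $ i) :: 'n rpoly"
  let ?q = "(\<Sum>i\<in>UNIV. pconst (g $ i) * ?l i) + pconst c * (\<Sum>i\<in>UNIV. ?l i ^ 2)"
  have l: "total_degree (?l i) \<le> 1" for i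
    by (intro total_degree_diff_le total_degree_var) simp
  have "total_degree (\<Sum>i\<in>UNIV. pconst (g $ i) * ?l i) \<le> 0 + 1"
    by (intro total_degree_sum_le total_degree_mult_le l) simp
  moreover have "total_degree (pconst c * (\<Sum>i\<in>UNIV. ?l i ^ 2)) \<le> 0 + 1 * 2"
    by (intro total_degree_sum_le total_degree_mult_le total_degree_power_le l) simp
  ultimately show "total_degree ?q \<le> 2"
    by (intro total_degree_add_le) simp_all
  show "peval ?q x = g \<bullet> (x - a) + c * (norm (x - a))\<^sup>2" for x
    unfolding power2_norm_eq_inner by (simp add: inner_vec_def power2_eq_square)
qed

lemma lasserre_bound_error:
  fixes f :: "'n::finite rpoly"
  assumes "convex_body K" and r: "1 \<le> r"
    and M: "C1 K f * diameter K + C2 K f * (diameter K)\<^sup>2 < M"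
  shows "lasserre_bound K f (2 * r) - f_min K f \<le> real CARD('n) * M / (2 * real r)"
proof -
  have K: "compact K" "convex K" "interior K \<noteq> {}"
    using assms(1) by (auto simp: convex_body_def)
  then have ne: "K \<noteq> {}" by auto
  obtain a where a: "a \<in> K" "\<And>x. x \<in> K \<Longrightarrow> peval f a \<le> peval f x"
    using continuous_attains_inf[OF K(1) ne continuous_on_peval[of K f]] by blast
  have fmin: "f_min K f = peval f a"
    unfolding f_min_def using a by (intro cInf_eq_minimum) auto
  let ?g = "grad (peval f) a" and ?c = "C2 K f / 2"
  obtain q :: "'n rpoly" where deg_q: "total_degree q \<le> 2"
    and q: "\<And>x. peval q x = ?g \<bullet> (x - a) + ?c * (norm (x - a))\<^sup>2"
    using quadratic_poly by blast
  have C: "0 \<le> C1 K f" "0 \<le> C2 K f"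
    using C1_nonneg C2_nonneg K(1) ne by auto
  \<comment> \<open>The strict inequality in the hypothesis on \<open>M\<close> keeps
    \<open>M\<close> positive even when \<open>C1\<close> and \<open>C2\<close> vanish, so division
    by \<open>M\<close> is safe.\<close>
  have M0: "0 < M"
    using M C diameter_ge_0[OF compact_imp_bounded[OF K(1)]]
    by (smt (verit) mult_nonneg_nonneg zero_le_power2)
  define y where "y = (\<lambda>x. peval q x / M)"
  have y_cont: "continuous_on K y"
    unfolding y_def using M0 by (intro continuous_intros) auto
  have grad_nonneg: "0 \<le> ?g \<bullet> (x - a)" if "x \<in> K" for x
    using K(2) a(1) that a(2) by (rule peval_minimizer_grad_nonneg)
  have y_range: "0 \<le> y x \<and> y x < 1" if x: "x \<in> K" for x
  proof -
    have d: "norm (x - a) \<le> diameter K"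
      using diameter_bounded_bound[OF compact_imp_bounded[OF K(1)] x a(1)] by (simp add: dist_norm)
    have "?g \<bullet> (x - a) \<le> norm ?g * norm (x - a)" by (rule norm_cauchy_schwarz)
    also have "\<dots> \<le> C1 K f * diameter K"
      using C1_upper[OF K(1) a(1)] d C by (intro mult_mono) auto
    finally have "?g \<bullet> (x - a) \<le> C1 K f * diameter K" .
    moreover have "?c * (norm (x - a))\<^sup>2 \<le> C2 K f * (diameter K)\<^sup>2"
      using C d by (intro mult_mono power_mono) auto
    ultimately have "peval q x < M" using M by (simp add: q)
    moreover have "0 \<le> peval q x" using grad_nonneg[OF x] C by (simp add: q)
    ultimately show ?thesis using M0 by (simp add: y_def)
  qed
  \<comment> \<open>Under dilation the linear term scales by \<open>t\<close> and the quadratic one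
    by \<open>t\<^sup>2\<close>, which is at most \<open>t\<close>.\<close>
  have y_star: "y ((1 - t) *\<^sub>R a + t *\<^sub>R x) \<le> t * y x" if "x \<in> K" "0 < t" "t < 1" for x t
  proof -
    have eq: "(1 - t) *\<^sub>R a + t *\<^sub>R x - a = t *\<^sub>R (x - a)" by (simp add: algebra_simps)
    have "?g \<bullet> (t *\<^sub>R v) + ?c * (norm (t *\<^sub>R v))\<^sup>2 \<le> t * (?g \<bullet> v + ?c * (norm v)\<^sup>2)" for v
    proof -
      have "t\<^sup>2 * (?c * (norm v)\<^sup>2) \<le> t * (?c * (norm v)\<^sup>2)"
        using that C by (intro mult_right_mono) (auto simp: power2_eq_square intro: mult_left_le)
      then show ?thesis by (simp add: power_mult_distrib algebra_simps)
    qed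
    then have "peval q ((1 - t) *\<^sub>R a + t *\<^sub>R x) \<le> t * peval q x"
      unfolding q eq .
    then show ?thesis using M0 by (simp add: y_def divide_right_mono)
  qed
  let ?w = "LINT x:K|lborel. (1 - y x) ^ (2 * r)"
  have w: "0 < ?w"
    using y_range by (intro set_integral_compact_pos K continuous_intros y_cont) simp
  \<comment> \<open>The degree of \<open>u\<close> is at most \<open>2 * r\<close>, so its square
    meets the limit \<open>4 * r\<close> for order \<open>2 * r\<close>; the factor
    \<open>1 / sqrt ?w\<close> normalises the integral of the square.\<close>
  define u where "u = pconst (1 / sqrt ?w) * (1 - pconst (1 / M) * q) ^ r"
  have h: "peval (u ^ 2) x = (1 - y x) ^ (2 * r) / ?w" for x
    using w by (simp add: u_def y_def power_mult_distrib power_divide power_mult[symmetric] mult.commute)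
  have "total_degree u \<le> 0 + (0 + 2) * r"
    unfolding u_def using deg_q
    by (intro total_degree_mult_le total_degree_power_le total_degree_diff_le) simp_all
  then have "total_degree (u ^ 2) \<le> 2 * r * 2"
    by (intro total_degree_power_le) simp
  then have sos: "u ^ 2 \<in> sos_polys (2 * r)"
    unfolding sos_polys_def by (auto intro!: exI[of _ "[u]"])
  have int1: "(LINT x:K|lborel. peval (u ^ 2) x) = 1"
    using w by (simp only: h set_integral_divide_zero) simp
  let ?n = "real CARD('n)"
  let ?J = "LINT x:K|lborel. y x * (1 - y x) ^ (2 * r)"
  have "(?n + 2 * real r + 1) * ?J \<le> ?n * ?w"
    using set_integral_power_le[OF K(1,2) a(1) y_cont _ y_star, of "2 * r"] y_range
    by (simp add: less_imp_le add_ac)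
  moreover have J0: "0 \<le> ?J"
    unfolding set_lebesgue_integral_def
    by (rule Bochner_Integration.integral_nonneg) (auto simp: indicator_def y_range less_imp_le)
  ultimately have "2 * real r * ?J \<le> ?n * ?w"
    by (smt (verit) mult_right_mono of_nat_0_le_iff)
  then have J: "?J / ?w \<le> ?n / (2 * real r)"
    using w r by (simp add: field_simps)
  have "lasserre_bound K f (2 * r) \<le> (LINT x:K|lborel. peval (u ^ 2) x * peval f x)"
    by (rule lasserre_bound_le[OF K(1) sos int1])
  also have "\<dots> \<le> (LINT x:K|lborel. peval (u ^ 2) x * peval f a + M / ?w * (y x * (1 - y x) ^ (2 * r)))"
  proof (rule set_integral_mono)
    fix x assume x: "x \<in> K"
    have "peval f x \<le> peval f a + M * y x"
      using peval_le_quadratic[OF K(1,2) a(1) x, of f] M0 by (simp add: y_def q)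
    then have "peval (u ^ 2) x * peval f x \<le> peval (u ^ 2) x * (peval f a + M * y x)"
      by (intro mult_left_mono peval_sos_nonneg[OF sos])
    also have "\<dots> = peval (u ^ 2) x * peval f a + M / ?w * (y x * (1 - y x) ^ (2 * r))"
      unfolding h by (simp add: algebra_simps add_divide_distrib)
    finally show "peval (u ^ 2) x * peval f x
        \<le> peval (u ^ 2) x * peval f a + M / ?w * (y x * (1 - y x) ^ (2 * r))" .
  qed (intro set_integrable_compact K continuous_intros y_cont)+
  also have "\<dots> = (LINT x:K|lborel. peval (u ^ 2) x * peval f a)
      + (LINT x:K|lborel. M / ?w * (y x * (1 - y x) ^ (2 * r)))"
    by (intro set_integral_add set_integrable_compact K continuous_intros y_cont)
  also have "\<dots> = peval f a + M * (?J / ?w)"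
    by (simp only: set_integral_mult_left set_integral_mult_right int1) simp
  also have "\<dots> \<le> peval f a + M * (?n / (2 * real r))"
    using mult_left_mono[OF J, of M] M0 by linarith
  finally show ?thesis by (simp add: fmin mult.commute)
qed

section \<open>The rate with its explicit constant\<close>

theorem corollary4p3:
  fixes f :: "'n::finite rpoly" and K :: "(real ^ 'n) set"
  assumes "convex_body K"
  shows "(\<exists>c>0. \<forall>r::nat. r \<ge> 1 \<longrightarrow> lasserre_bound K f (2 * r) - f_min K f \<le> c / real r)
    \<and> (f_min K f \<ge> 0 \<longrightarrow>
        (\<forall>r::nat. r \<ge> 1 \<longrightarrow> lasserre_bound K f (2 * r) - f_min K f
           \<le> (real CARD('n) * exp 1 + 1)
              * (f_min K f + C1 K f * diameter K + C2 K f * (diameter K)\<^sup>2) / real r))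
    \<and> (\<forall>r::nat. r \<ge> 1 \<longrightarrow> lasserre_bound K f (2 * r) - f_min K f
           \<le> (real CARD('n) * exp 1 + 1)
              * (\<bar>f_min K f\<bar> + C1 K f * diameter K + C2 K f * (diameter K)\<^sup>2) / real r)"
proof -
  let ?n = "real CARD('n)"
  let ?B = "C1 K f * diameter K + C2 K f * (diameter K)\<^sup>2"
  have K: "compact K" "K \<noteq> {}"
    using assms by (auto simp: convex_body_def)
  have B0: "0 \<le> ?B"
    using C1_nonneg[OF K] C2_nonneg[OF K] diameter_ge_0[OF compact_imp_bounded[OF K(1)]] by simp
  have bound: "lasserre_bound K f (2 * r) - f_min K f \<le> ?n * ?B / real r" if "1 \<le> r" for r
  proof -
    have "lasserre_bound K f (2 * r) - f_min K f \<le> ?n * ?B / (2 * real r)"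
    \<comment> \<open>Letting \<open>M\<close> decrease to \<open>?B\<close> removes the strict
      inequality on \<open>M\<close>, and covers \<open>?B = 0\<close>.\<close>
    proof (rule tendsto_lowerbound)
      show "((\<lambda>M. ?n * M / (2 * real r)) \<longlongrightarrow> ?n * ?B / (2 * real r)) (at_right ?B)"
        using that by (intro tendsto_intros) simp
      show "\<forall>\<^sub>F M in at_right ?B. lasserre_bound K f (2 * r) - f_min K f \<le> ?n * M / (2 * real r)"
        using eventually_at_right_less by (rule eventually_mono) (rule lasserre_bound_error[OF assms that])
    qed simp
    also have "\<dots> \<le> ?n * ?B / real r"
      using that B0 by (intro divide_left_mono) auto
    finally show ?thesis .
  qed
  \<comment> \<open>The constant \<open>?n * ?B\<close> is the sharper one; the stated constant
    follows from \<open>1 \<le> exp 1\<close> and the nonnegativity of the absolute value.\<close>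
  have e1: "?n * ?B \<le> (?n * exp 1 + 1) * (\<bar>f_min K f\<bar> + ?B)"
  proof (rule mult_mono)
    have "?n * 1 \<le> ?n * exp 1" by (intro mult_left_mono) auto
    then show "?n \<le> ?n * exp 1 + 1" by linarith
  qed (use B0 in auto)
  have explicit: "lasserre_bound K f (2 * r) - f_min K f
      \<le> (?n * exp 1 + 1) * (\<bar>f_min K f\<bar> + C1 K f * diameter K + C2 K f * (diameter K)\<^sup>2) / real r"
    if "1 \<le> r" for r
    using bound[OF that] divide_right_mono[OF e1, of "real r"] by (simp add: add.assoc)
  have "\<exists>c>0. \<forall>r::nat. r \<ge> 1 \<longrightarrow> lasserre_bound K f (2 * r) - f_min K f \<le> c / real r"
  \<comment> \<open>The added \<open>1\<close> makes the constant positive when \<open>?B\<close> is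
    zero, as for constant \<open>f\<close>.\<close>
  proof (intro exI[of _ "?n * ?B + 1"] conjI allI impI)
    show "0 < ?n * ?B + 1"
      using mult_nonneg_nonneg[OF _ B0, of ?n] by simp
    show "lasserre_bound K f (2 * r) - f_min K f \<le> (?n * ?B + 1) / real r" if "1 \<le> r" for r
      using bound[OF that] by (rule order_trans) (simp add: divide_right_mono)
  qed
  then show ?thesis
  proof (intro conjI impI)
    assume "0 \<le> f_min K f"
    then have "\<bar>f_min K f\<bar> = f_min K f" by simp
    from explicit[unfolded this]
    show "\<forall>r::nat. r \<ge> 1 \<longrightarrow> lasserre_bound K f (2 * r) - f_min K f
        \<le> (?n * exp 1 + 1) * (f_min K f + C1 K f * diameter K + C2 K f * (diameter K)\<^sup>2) / real r"
      by blast
  qed (use explicit in blast)+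
qed

end
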